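(* Let $P$ be a normed space, and assume that for any $\lambda \in \Lambda$ there exists $d(\lambda) \ge 0$ such that $|\langle \lambda, p \rangle| \le d(\lambda) \| p \|$ for all $p \in P$. Suppose also that $\sigma(p) = \| p \|$ for all $p \in P$. Then an augmented Lagrange multiplier of $(\mathcal{P})$ exists if and only if the penalty function $F(x, r) = \inf_{p \in P} ( \Phi(x, p) + r \sigma(p) )$ is exact. Moreover, if $\mathcal{A}(\mathcal{P}) \ne \emptyset$, then $\mathcal{A}(\mathcal{P}) = \Lambda$.
   Context: Setting. $X$ is a topological space, $A \subset X$ is a nonempty set, $f \colon X \to \mathbb{R} \cup \{+\infty\}$, and $(\mathcal{P})$ denotes the problem of minimizing $f(x)$ subject to $x \in A$. It is assumed that $\{x \in A \mid f(x) < +\infty\} \ne \emptyset$ and that the optimal value $f^* = \inf_{x \in A} f(x)$ is finite. $P$ is a topological vector space of parameters (here a normed space), $\Lambda$ is a vector space of multipliers, and $\langle \cdot, \cdot \rangle \colon \Lambda \times P \to \mathbb{R}$ is a bilinear coupling function. $\Phi \colon X \times P \to \overline{\mathbb{R}} = \mathbb{R} \cup \{\pm\infty\}$ is a fixed dualizing parameterization function for $f$, i.e. $\Phi(x, 0) = f(x)$ for all $x \in X$. $\sigma \colon P \to [0, +\infty]$ is a fixed augmenting function, i.e. $\sigma(0) = 0$ and $\sigma(p) > 0$ for all $p \in P \setminus \{0\}$. The optimal value function is $v(p) = \inf_{x \in A} \Phi(x, p)$, so $v(0) = f^*$. A multiplier $\lambda \in \Lambda$ is an augmented Lagrange multiplier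 of $(\mathcal{P})$ if there exists $r \ge 0$ such that $v(p) \ge v(0) + \langle \lambda, p \rangle - r \sigma(p)$ for all $p \in P$. The set of all augmented Lagrange multipliers of $(\mathcal{P})$ is denoted $\mathcal{A}(\mathcal{P})$. The penalty function $F(x, r)$ ($x \in X$, $r \ge 0$) is called exact if there exists $r \ge 0$ such that $F(x, r) \ge f^*$ for all $x \in A$. *)

theory Defs
  imports "HOL-Analysis.Analysis"
begin

text \<open>
  The space of points, the parameter space and the space of multipliers are types;
  the extended reals are \<^typ>\<open>ereal\<close>. The coupling function is a parameter \<open>pair\<close>,
  and \<open>pair l p\<close> is the coupling of a multiplier \<open>l\<close> with a parameter \<open>p\<close>.

  In \<^typ>\<open>ereal\<close>, \<open>0 * \<infinity> = 0\<close> and \<open>-\<infinity> + \<infinity> = \<infinity>\<close>. These conventions matter below only where an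
  augmenting function takes the value \<open>\<infinity>\<close>.
\<close>

definition optimal_value :: "'x set \<Rightarrow> ('x \<Rightarrow> ereal) \<Rightarrow> ereal" where
  "optimal_value A f = (INF x\<in>A. f x)"

definition dualizing_param :: "('x \<Rightarrow> ereal) \<Rightarrow> ('x \<Rightarrow> 'p::real_vector \<Rightarrow> ereal) \<Rightarrow> bool" where
  "dualizing_param f \<Phi> \<longleftrightarrow> (\<forall>x. \<Phi> x 0 = f x)"

definition augmenting_function :: "('p::real_vector \<Rightarrow> ereal) \<Rightarrow> bool" where
  "augmenting_function \<sigma> \<longleftrightarrow> \<sigma> 0 = 0 \<and> (\<forall>p. p \<noteq> 0 \<longrightarrow> \<sigma> p > 0)"

definition optimal_value_function :: "'x set \<Rightarrow> ('x \<Rightarrow> 'p \<Rightarrow> ereal) \<Rightarrow> 'p \<Rightarrow> ereal" where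
  "optimal_value_function A \<Phi> p = (INF x\<in>A. \<Phi> x p)"

definition augmented_Lagrange_multiplier ::
    "'x set \<Rightarrow> ('x \<Rightarrow> 'p::real_vector \<Rightarrow> ereal) \<Rightarrow> ('p \<Rightarrow> ereal) \<Rightarrow>
     ('l::real_vector \<Rightarrow> 'p \<Rightarrow> real) \<Rightarrow> 'l \<Rightarrow> bool" where
  "augmented_Lagrange_multiplier A \<Phi> \<sigma> pair l \<longleftrightarrow>
     (\<exists>r::real. r \<ge> 0 \<and>
       (\<forall>p. optimal_value_function A \<Phi> p \<ge>
              optimal_value_function A \<Phi> 0 + ereal (pair l p) - ereal r * \<sigma> p))"

definition augmented_Lagrange_multipliers ::
    "'x set \<Rightarrow> ('x \<Rightarrow> 'p::real_vector \<Rightarrow> ereal) \<Rightarrow> ('p \<Rightarrow> ereal) \<Rightarrow>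
     ('l::real_vector \<Rightarrow> 'p \<Rightarrow> real) \<Rightarrow> 'l set" where
  "augmented_Lagrange_multipliers A \<Phi> \<sigma> pair = {l. augmented_Lagrange_multiplier A \<Phi> \<sigma> pair l}"

definition penalty_function ::
    "('x \<Rightarrow> 'p \<Rightarrow> ereal) \<Rightarrow> ('p \<Rightarrow> ereal) \<Rightarrow> 'x \<Rightarrow> real \<Rightarrow> ereal" where
  "penalty_function \<Phi> \<sigma> x r = (INF p. \<Phi> x p + ereal r * \<sigma> p)"

definition exact_penalty ::
    "'x set \<Rightarrow> ('x \<Rightarrow> ereal) \<Rightarrow> ('x \<Rightarrow> real \<Rightarrow> ereal) \<Rightarrow> bool" where
  "exact_penalty A f F \<longleftrightarrow> (\<exists>r::real. r \<ge> 0 \<and> (\<forall>x\<in>A. F x r \<ge> optimal_value A f))"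

end

theory Submission
  imports Defs
begin

text \<open>
  Both sides say that \<open>v\<close> has a conical minorant \<open>v p \<ge> f\<^sup>* - r * norm p\<close> with apex at \<open>0\<close>: for the
  penalty function this is an interchange of the infima over \<open>x\<close> and \<open>p\<close>, and for a multiplier the
  linear term is absorbed by increasing \<open>r\<close> by \<open>d l\<close>. The conical bound does not mention the multiplier,
  so if one multiplier exists, then every element of \<open>\<Lambda>\<close> is one.
\<close>

text \<open>A lower bound on an infimum is a bound on each term, so both sides unfold to one
  inequality for all \<open>x\<close> in \<open>A\<close> and all \<open>p\<close>, with the same
  \<open>r\<close>.\<close>

lemma exact_penalty_norm_iff:
  fixes \<Phi> :: "'x \<Rightarrow> 'p::real_normed_vector \<Rightarrow> ereal"
  assumes c: "optimal_value A f = ereal c"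
  shows "exact_penalty A f (penalty_function \<Phi> (\<lambda>p. ereal (norm p))) \<longleftrightarrow>
    (\<exists>r\<ge>0. \<forall>p. ereal (c - r * norm p) \<le> optimal_value_function A \<Phi> p)"
proof -
  \<comment> \<open>The penalty term is a real number, so it can change sides even where
    \<open>\<Phi> x p\<close> is infinite.\<close>
  have "ereal c \<le> \<Phi> x p + ereal r * ereal (norm p) \<longleftrightarrow> ereal (c - r * norm p) \<le> \<Phi> x p" for x p r
    by (cases "\<Phi> x p") (auto simp: algebra_simps)
  then show ?thesis
    unfolding exact_penalty_def penalty_function_def optimal_value_function_def c le_INF_iff
    by auto
qed

lemma augmented_Lagrange_multiplier_norm_iff:
  fixes \<Phi> :: "'x \<Rightarrow> 'p::real_normed_vector \<Rightarrow> ereal"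
    and pair :: "'l::real_vector \<Rightarrow> 'p \<Rightarrow> real"
  assumes c: "optimal_value_function A \<Phi> 0 = ereal c"
    and "d \<ge> 0" and d: "\<And>p. \<bar>pair l p\<bar> \<le> d * norm p"
  shows "augmented_Lagrange_multiplier A \<Phi> (\<lambda>p. ereal (norm p)) pair l \<longleftrightarrow>
    (\<exists>r\<ge>0. \<forall>p. ereal (c - r * norm p) \<le> optimal_value_function A \<Phi> p)"
    (is "_ \<longleftrightarrow> (\<exists>r\<ge>0. \<forall>p. ?cone r p)")
proof -
  let ?mult = "\<lambda>r p. ereal (c + pair l p - r * norm p) \<le> optimal_value_function A \<Phi> p"
  have bounds: "- (d * norm p) \<le> pair l p" "pair l p \<le> d * norm p" for p
    using d[of p] by auto
  \<comment> \<open>Dropping the linear term uses the lower bound on \<open>pair l p\<close>, adding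
    it the upper one; either way \<open>r\<close> grows by \<open>d\<close>.\<close>
  have 1: "?cone (r + d) p" if "?mult r p" for r p
    by (rule order_trans[OF _ that]) (use bounds[of p] in \<open>simp add: algebra_simps\<close>)
  have 2: "?mult (r + d) p" if "?cone r p" for r p
    by (rule order_trans[OF _ that]) (use bounds[of p] in \<open>simp add: algebra_simps\<close>)
  have "augmented_Lagrange_multiplier A \<Phi> (\<lambda>p. ereal (norm p)) pair l \<longleftrightarrow>
      (\<exists>r\<ge>0. \<forall>p. ?mult r p)"
    by (simp add: augmented_Lagrange_multiplier_def c)
  also have "\<dots> \<longleftrightarrow> (\<exists>r\<ge>0. \<forall>p. ?cone r p)"
    using 1 2 \<open>d \<ge> 0\<close> by (meson add_nonneg_nonneg)
  finally show ?thesis .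
qed

theorem proposition5:
  fixes A :: "'x::topological_space set"
    and f :: "'x \<Rightarrow> ereal"
    and \<Phi> :: "'x \<Rightarrow> 'p::real_normed_vector \<Rightarrow> ereal"
    and \<sigma> :: "'p \<Rightarrow> ereal"
    and pair :: "'l::real_vector \<Rightarrow> 'p \<Rightarrow> real"
  assumes "A \<noteq> {}"
    and "\<forall>x. f x \<noteq> -\<infinity>"
    and "{x \<in> A. f x < \<infinity>} \<noteq> {}"
    and "\<bar>optimal_value A f\<bar> \<noteq> \<infinity>"
    and "bilinear pair"
    and "dualizing_param f \<Phi>"
    and "augmenting_function \<sigma>"
    and "\<forall>l. \<exists>d\<ge>0. \<forall>p. \<bar>pair l p\<bar> \<le> d * norm p"
    and "\<forall>p. \<sigma> p = ereal (norm p)"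
  shows "((\<exists>l. augmented_Lagrange_multiplier A \<Phi> \<sigma> pair l) \<longleftrightarrow>
            exact_penalty A f (penalty_function \<Phi> \<sigma>)) \<and>
         (augmented_Lagrange_multipliers A \<Phi> \<sigma> pair \<noteq> {} \<longrightarrow>
            augmented_Lagrange_multipliers A \<Phi> \<sigma> pair = UNIV)"
proof -
  have \<sigma>: "\<sigma> = (\<lambda>p. ereal (norm p))"
    using assms(9) by auto
  obtain c where c: "optimal_value A f = ereal c"
    using assms(4) by auto
  \<comment> \<open>Both lemmas now have the same apex value \<open>c\<close>, so their right-hand
    sides coincide.\<close>
  have v0: "optimal_value_function A \<Phi> 0 = ereal c"
    using assms(6) c by (simp add: optimal_value_function_def optimal_value_def dualizing_param_def)
  \<comment> \<open>The right-hand side is free of \<open>l\<close>, so either all multipliers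
    qualify or none does; existence follows from exactness because a type is nonempty.\<close>
  have "augmented_Lagrange_multiplier A \<Phi> \<sigma> pair l \<longleftrightarrow>
      exact_penalty A f (penalty_function \<Phi> \<sigma>)" for l
    using assms(8) augmented_Lagrange_multiplier_norm_iff[OF v0]
    unfolding \<sigma> exact_penalty_norm_iff[OF c] by blast
  then show ?thesis
    by (auto simp: augmented_Lagrange_multipliers_def)
qed

end
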